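(* Let $(R,\mathfrak m,k)$ be a commutative Noetherian local ring. Suppose that $k$ is infinite and $R$ is not a field. Let $I$ be an integrally closed ideal of $R$ such that $\operatorname{depth}(R/I)=0$. Then the ideal $I$ is Burch.
   Context: An ideal $I$ of $R$ is Burch if $\mathfrak m(I:_R\mathfrak m)\ne\mathfrak mI$. Convention: $\operatorname{depth}(0)=\infty$. *)

theory Defs
  imports
    "HOL-Algebra.Module"
    "HOL-Algebra.QuotRing"
    "HOL-Algebra.Ideal_Product"
    "HOL-Algebra.Ring_Divisibility"
    "HOL-Library.Extended_Nat"
begin

section \<open>Noetherian local rings\<close>

locale noetherian_local_ring = cring R + noetherian_ring R + maximalideal \<mm> R
  for R (structure) and \<mm> +
  assumes unique_maximal: "maximalideal J R \<Longrightarrow> J = \<mm>"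

section \<open>Colon ideals and Burch ideals\<close>

definition colon :: "('a, 'b) ring_scheme \<Rightarrow> 'a set \<Rightarrow> 'a set \<Rightarrow> 'a set"
  where "colon R I J = {r \<in> carrier R. \<forall>x\<in>J. r \<otimes>\<^bsub>R\<^esub> x \<in> I}"

definition burch :: "('a, 'b) ring_scheme \<Rightarrow> 'a set \<Rightarrow> 'a set \<Rightarrow> bool"
  where "burch R \<mm> I \<longleftrightarrow> \<mm> \<cdot>\<^bsub>R\<^esub> colon R I \<mm> \<noteq> \<mm> \<cdot>\<^bsub>R\<^esub> I"

section \<open>Integral closure of an ideal\<close>

text \<open>Powers of ideals are powers in the multiplicative monoid of \<^term>\<open>ideals_set R\<close>, so that
  \<open>I\<close> to the power \<open>0\<close> is \<^term>\<open>carrier R\<close>.  An element \<open>r\<close> is integral over \<open>I\<close> if it satisfies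
  an equation \<open>r^n + a_1 r^(n-1) + \<dots> + a_n = 0\<close> with \<open>n \<ge> 1\<close> and \<open>a_i \<in> I^i\<close>.\<close>

definition integral_closure_ideal :: "('a, 'b) ring_scheme \<Rightarrow> 'a set \<Rightarrow> 'a set"
  where "integral_closure_ideal R I =
    {r \<in> carrier R. \<exists>(n::nat) a. n \<ge> 1 \<and>
       (\<forall>i\<in>{1..n}. a i \<in> I [^]\<^bsub>ideals_set R\<^esub> i) \<and>
       r [^]\<^bsub>R\<^esub> n \<oplus>\<^bsub>R\<^esub> (\<Oplus>\<^bsub>R\<^esub>i\<in>{1..n}. a i \<otimes>\<^bsub>R\<^esub> r [^]\<^bsub>R\<^esub> (n - i)) = \<zero>\<^bsub>R\<^esub>}"

definition integrally_closed_ideal :: "('a, 'b) ring_scheme \<Rightarrow> 'a set \<Rightarrow> bool"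
  where "integrally_closed_ideal R I \<longleftrightarrow> ideal I R \<and> integral_closure_ideal R I = I"

section \<open>Modules and depth\<close>

definition self_module :: "('a, 'b) ring_scheme \<Rightarrow> ('a, 'a) module"
  where "self_module R =
    \<lparr>carrier = carrier R, monoid.mult = monoid.mult R, one = one R, zero = zero R,
     add = add R, smult = monoid.mult R\<rparr>"

text \<open>Records of type \<^type>\<open>module\<close> carry fields \<^const>\<open>monoid.mult\<close> and \<^const>\<open>one\<close>
  that play no role for modules; they are left unspecified here.\<close>

definition quot_module :: "('a, 'b, 'c) module_scheme \<Rightarrow> 'b set \<Rightarrow> ('a, 'b set) module"
  where "quot_module M N =
    \<lparr>carrier = a_rcosets\<^bsub>M\<^esub> N, monoid.mult = undefined, one = undefined, zero = N, add = set_add M,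
     smult = (\<lambda>r X. \<Union>x\<in>X. N +>\<^bsub>M\<^esub> (r \<odot>\<^bsub>M\<^esub> x))\<rparr>"

lemma module_self_module: assumes "cring R" shows "module R (self_module R)"
proof -
  interpret cring R by fact
  have minus: "\<exists>y\<in>carrier R. y \<oplus>\<^bsub>R\<^esub> x = \<zero>\<^bsub>R\<^esub>" if "x \<in> carrier R" for x
    using that l_neg a_inv_closed by metis
  show ?thesis
    unfolding self_module_def
    by (intro moduleI assms abelian_groupI) (simp_all add: a_ac l_distr r_distr m_assoc minus)
qed

lemma smult_quot_module:
  assumes "module R M" "submodule N R M" "r \<in> carrier R" "x \<in> carrier M"
  shows "r \<odot>\<^bsub>quot_module M N\<^esub> (N +>\<^bsub>M\<^esub> x) = N +>\<^bsub>M\<^esub> (r \<odot>\<^bsub>M\<^esub> x)"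
proof -
  interpret module R M by fact
  interpret N: submodule N R M by fact
  have sg: "subgroup N (add_monoid M)" by (rule N.subgroup_axioms)
  interpret A: abelian_subgroup N M
    by (intro abelian_subgroupI3) (auto simp: additive_subgroup_def sg M.abelian_group_axioms)
  have *: "N +>\<^bsub>M\<^esub> (r \<odot>\<^bsub>M\<^esub> y) = N +>\<^bsub>M\<^esub> (r \<odot>\<^bsub>M\<^esub> x)" if y: "y \<in> N +>\<^bsub>M\<^esub> x" for y
  proof -
    obtain h where h: "h \<in> N" "y = h \<oplus>\<^bsub>M\<^esub> x" using y by (auto simp: a_r_coset_def')
    have "h \<in> carrier M" using h A.a_subset by auto
    then have "r \<odot>\<^bsub>M\<^esub> y = r \<odot>\<^bsub>M\<^esub> h \<oplus>\<^bsub>M\<^esub> r \<odot>\<^bsub>M\<^esub> x" using h assms smult_r_distr by auto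
    moreover have "r \<odot>\<^bsub>M\<^esub> h \<in> N" using h assms by auto
    ultimately have "r \<odot>\<^bsub>M\<^esub> y \<in> N +>\<^bsub>M\<^esub> (r \<odot>\<^bsub>M\<^esub> x)" by (auto simp: a_r_coset_def')
    then show ?thesis using M.a_repr_independence[OF _ _ sg] assms by (metis smult_closed)
  qed
  have "x \<in> N +>\<^bsub>M\<^esub> x" using A.a_rcos_self assms by auto
  moreover have "(\<Union>y\<in>N +>\<^bsub>M\<^esub> x. N +>\<^bsub>M\<^esub> (r \<odot>\<^bsub>M\<^esub> y)) =
      (\<Union>y\<in>N +>\<^bsub>M\<^esub> x. N +>\<^bsub>M\<^esub> (r \<odot>\<^bsub>M\<^esub> x))"
    by (rule SUP_cong[OF refl *])
  ultimately show ?thesis unfolding quot_module_def module.simps UN_constant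
    by (metis empty_iff)
qed

lemma module_quot_module:
  assumes "module R M" "submodule N R M"
  shows "module R (quot_module M N)"
proof -
  interpret module R M by fact
  interpret N: submodule N R M by fact
  have sg: "subgroup N (add_monoid M)" by (rule N.subgroup_axioms)
  interpret A: abelian_subgroup N M
    by (intro abelian_subgroupI3) (auto simp: additive_subgroup_def sg M.abelian_group_axioms)
  let ?Q = "quot_module M N"
  have car: "carrier ?Q = {N +>\<^bsub>M\<^esub> x |x. x \<in> carrier M}"
    by (auto simp: quot_module_def A_RCOSETS_def')
  have ad: "(N +>\<^bsub>M\<^esub> x) \<oplus>\<^bsub>?Q\<^esub> (N +>\<^bsub>M\<^esub> y) = N +>\<^bsub>M\<^esub> (x \<oplus>\<^bsub>M\<^esub> y)"
    if "x \<in> carrier M" "y \<in> carrier M" for x y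
    using that A.a_rcos_sum by (simp add: quot_module_def)
  have z: "\<zero>\<^bsub>?Q\<^esub> = N +>\<^bsub>M\<^esub> \<zero>\<^bsub>M\<^esub>" using A.a_subset by (simp add: quot_module_def M.a_coset_add_zero)
  have minus: "\<exists>y. (\<exists>x'. y = N +>\<^bsub>M\<^esub> x' \<and> x' \<in> carrier M) \<and>
      y \<oplus>\<^bsub>?Q\<^esub> (N +>\<^bsub>M\<^esub> x) = N +>\<^bsub>M\<^esub> \<zero>\<^bsub>M\<^esub>" if "x \<in> carrier M" for x
    using that ad[of "\<ominus>\<^bsub>M\<^esub> x" x] by (intro exI[of _ "N +>\<^bsub>M\<^esub> (\<ominus>\<^bsub>M\<^esub> x)"]) (auto simp: M.l_neg)
  show ?thesis
    apply (rule moduleI)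
    apply (rule R.cring_axioms)
    apply (rule abelian_groupI)
    using minus by (auto simp: car z ad smult_quot_module[OF assms] M.a_ac
        smult_l_distr smult_r_distr smult_assoc1)
qed

lemma submodule_self_module:
  assumes "cring R" "ideal I R" shows "submodule I R (self_module R)"
proof -
  interpret cring R by fact
  interpret ideal I R by fact
  interpret m: module R "self_module R" using assms module_self_module by blast
  have [simp]: "x \<in> I \<Longrightarrow> \<ominus>\<^bsub>self_module R\<^esub> x = \<ominus>\<^bsub>R\<^esub> x" for x
    by (simp add: a_inv_def self_module_def m_inv_def)
  show ?thesis
  proof (rule m.submoduleI)
    show "I \<subseteq> carrier (self_module R)" using a_subset by (simp add: self_module_def)
    show "\<zero>\<^bsub>self_module R\<^esub> \<in> I" using zero_closed by (simp add: self_module_def)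
  next
    fix x y assume "x \<in> I" "y \<in> I"
    then show "x \<oplus>\<^bsub>self_module R\<^esub> y \<in> I" using a_closed by (simp add: self_module_def)
  next
    fix r x assume "r \<in> carrier R" "x \<in> I"
    then show "r \<odot>\<^bsub>self_module R\<^esub> x \<in> I" using I_l_closed by (simp add: self_module_def)
  next
    fix x assume "x \<in> I"
    then show "\<ominus>\<^bsub>self_module R\<^esub> x \<in> I" using a_inv_closed by simp
  qed
qed

text \<open>The submodule \<open>J M\<close>, for an ideal \<open>J\<close> of \<open>R\<close>.\<close>

definition ideal_smult ::
  "('a, 'd) ring_scheme \<Rightarrow> 'a set \<Rightarrow> ('a, 'b, 'c) module_scheme \<Rightarrow> 'b set"
  where "ideal_smult R J M =
    \<Inter>{N. submodule N R M \<and> (\<forall>a\<in>J. \<forall>x\<in>carrier M. a \<odot>\<^bsub>M\<^esub> x \<in> N)}"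

definition nonzerodivisor_on :: "('a, 'b, 'c) module_scheme \<Rightarrow> 'a \<Rightarrow> bool"
  where "nonzerodivisor_on M x \<longleftrightarrow> (\<forall>z\<in>carrier M. x \<odot>\<^bsub>M\<^esub> z = \<zero>\<^bsub>M\<^esub> \<longrightarrow> z = \<zero>\<^bsub>M\<^esub>)"

text \<open>A list \<open>x\<^sub>1, \<dots>, x\<^sub>n\<close> is \<open>M\<close>-regular if each entry is a nonzerodivisor on \<open>M\<close> modulo the
  preceding entries, and \<open>(x\<^sub>1, \<dots>, x\<^sub>n) M \<noteq> M\<close>.\<close>

definition regular_sequence ::
  "('a, 'd) ring_scheme \<Rightarrow> ('a, 'b, 'c) module_scheme \<Rightarrow> 'a list \<Rightarrow> bool"
  where "regular_sequence R M xs \<longleftrightarrow> set xs \<subseteq> carrier R \<and>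
    (\<forall>i<length xs.
       nonzerodivisor_on (quot_module M (ideal_smult R (Idl\<^bsub>R\<^esub> (set (take i xs))) M)) (xs ! i)) \<and>
    ideal_smult R (Idl\<^bsub>R\<^esub> (set xs)) M \<noteq> carrier M"

text \<open>The depth of a finitely generated module \<open>M\<close> over a Noetherian local ring with maximal ideal
  \<open>\<mm>\<close>: the supremum of the lengths of \<open>M\<close>-regular sequences in \<open>\<mm>\<close>.  The zero module has no regular
  sequences; its depth is \<open>\<infinity>\<close> by convention.\<close>

definition depth ::
  "('a, 'd) ring_scheme \<Rightarrow> 'a set \<Rightarrow> ('a, 'b, 'c) module_scheme \<Rightarrow> enat"
  where "depth R \<mm> M =
    (if carrier M = {\<zero>\<^bsub>M\<^esub>} then \<infinity>
     else (SUP xs \<in> {xs. set xs \<subseteq> \<mm> \<and> regular_sequence R M xs}. enat (length xs)))"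

end

theory Submission
  imports Defs
begin

text \<open>
  As \<open>R/I\<close> has depth zero, every element of \<open>\<mm>\<close> is a zero divisor on \<open>R/I\<close>.  Since \<open>R\<close> is
  Noetherian, prime avoidance provides one element \<open>z \<notin> I\<close> with \<open>z \<mm> \<subseteq> I\<close>, that is, \<open>z \<in> (I : \<mm>) - I\<close>
  (lemma \<open>ideal_of_zero_divisors_mod\<close>).

  Suppose that \<open>I\<close> is not Burch, so that \<open>\<mm> (I : \<mm>) = \<mm> I\<close>.  Then \<open>z \<mm> \<subseteq> \<mm> I\<close>.  By the
  Cayley-Hamilton argument for the finitely generated ideal \<open>\<mm>\<close> there is a value
  \<open>s = z^n + a\<^sub>1 z^(n-1) + \<dots> + a\<^sub>n\<close> with \<open>n \<ge> 1\<close> and \<open>a\<^sub>i \<in> I^i\<close> that annihilates \<open>\<mm>\<close> (lemma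
  \<open>monic_annihilates_stable_ideal\<close>).  The ideal \<open>\<mm>\<close> need not contain a nonzerodivisor, so \<open>s\<close> need not
  vanish.  But \<open>\<mm> \<noteq> 0\<close>, because \<open>R\<close> is not a field; so \<open>s\<close> is not a unit, \<open>s \<in> \<mm>\<close>, and
  \<open>s\<^sup>2 = 0\<close>.  Expanding \<open>s\<^sup>2\<close> gives an equation of integral dependence of \<open>z\<close> over \<open>I\<close>, of degree \<open>2 n\<close>.
  As \<open>I\<close> is integrally closed, \<open>z \<in> I\<close>, a contradiction.

  The Cayley-Hamilton argument is carried out by elimination of one generator at a time instead of
  by a determinant (lemma \<open>monic_annihilates_generators\<close>).  All that it needs is that values of monic
  equations of integral dependence are closed under multiplication and under perturbation by terms of
  lower order in \<open>z\<close>.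
\<close>

section \<open>Zero divisors modulo an ideal of a Noetherian ring\<close>

lemma (in noetherian_ring) exists_maximal_ideal_above:
  assumes "\<And>J. J \<in> S \<Longrightarrow> ideal J R" and "J \<in> S"
  shows "\<exists>M\<in>S. J \<subseteq> M \<and> (\<forall>K\<in>S. M \<subseteq> K \<longrightarrow> K = M)"
proof -
  let ?S = "{K \<in> S. J \<subseteq> K}"
  have "\<exists>M\<in>?S. \<forall>X\<in>?S. M \<subseteq> X \<longrightarrow> X = M"
  proof (rule subset_Zorn_nonempty)
    show "?S \<noteq> {}" using assms(2) by blast
  next
    fix C assume C: "C \<noteq> {}" "subset.chain ?S C"
    then have "subset.chain {I. ideal I R} C"
      using assms(1) unfolding subset_chain_def by blast
    then have "\<Union>C \<in> C" using ideal_chain_is_trivial C(1) by blast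
    then show "\<Union>C \<in> ?S" using C(2) unfolding subset_chain_def by blast
  qed
  then obtain M where M: "M \<in> S" "J \<subseteq> M" "\<forall>X\<in>?S. M \<subseteq> X \<longrightarrow> X = M" by auto
  have "\<forall>K\<in>S. M \<subseteq> K \<longrightarrow> K = M"
  proof (intro ballI impI)
    fix K assume "K \<in> S" "M \<subseteq> K"
    then show "K = M" using M(2,3) by simp
  qed
  then show ?thesis using M(1,2) by blast
qed

lemma (in cring) colon_singleton_ideal:
  assumes "ideal I R" "z \<in> carrier R"
  shows "ideal (colon R I {z}) R"
proof -
  have "colon R I {z} = {r \<in> carrier R. z \<otimes> r \<in> I}"
    using assms(2) by (auto simp: colon_def m_comm)
  then show ?thesis using ideal.helper_max_prime[OF assms(1) is_cring assms(2)] by simp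
qed

text \<open>A product of elements outside a prime ideal stays outside it, so choosing an element of
  \<open>P - Q\<close> for every member \<open>P\<close> of the family and multiplying the choices gives \<open>y\<close>.\<close>

lemma (in cring) prime_not_contains_Inter:
  assumes "primeideal Q R" "finite F" "\<And>P. P \<in> F \<Longrightarrow> ideal P R \<and> \<not> P \<subseteq> Q"
  shows "\<exists>y\<in>carrier R. y \<notin> Q \<and> (\<forall>P\<in>F. y \<in> P)"
  using assms(2,3)
proof (induction F rule: finite_induct)
  case empty
  have "\<one> \<notin> Q"
    using primeideal.I_notcarr[OF assms(1)] primeideal.axioms(1)[OF assms(1)]
      ideal.one_imp_carrier by blast
  then show ?case by (intro bexI[of _ \<one>]) auto
next
  case (insert P F)
  then obtain y where y: "y \<in> carrier R" "y \<notin> Q" "\<forall>P\<in>F. y \<in> P" by auto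
  obtain p where p: "p \<in> P" "p \<notin> Q" using insert.prems by blast
  have pc: "p \<in> carrier R" using p(1) insert.prems[of P] ideal.Icarr[of P R p] by simp
  have "p \<otimes> y \<notin> Q" using primeideal.I_prime[OF assms(1) pc y(1)] p y by blast
  moreover have "p \<otimes> y \<in> P'" if "P' \<in> insert P F" for P'
  proof (cases "P' = P")
    case True
    then show ?thesis using insert.prems[of P] p(1) y(1) by (simp add: ideal.I_r_closed)
  next
    case False
    then show ?thesis using that insert.prems[of P'] y(3) pc by (simp add: ideal.I_l_closed)
  qed
  ultimately show ?case using pc y by (intro bexI[of _ "p \<otimes> y"]) auto
qed

text \<open>Induction on \<open>F\<close>.  Suppose \<open>x \<in> J\<close> avoids all of \<open>F\<close> but lies in the new prime \<open>P\<close>.  As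
  neither \<open>J\<close> nor another member of \<open>F\<close> is contained in \<open>P\<close>, there is \<open>y \<in> J\<close> that lies in all the
  other members and not in \<open>P\<close>; then \<open>x + y\<close> avoids every prime.  Incomparability
  keeps the argument short, and it holds for the annihilators considered below, as they are all
  maximal in one family.\<close>

lemma (in cring) prime_avoidance_antichain:
  assumes "ideal J R" "finite F"
    and "\<And>P. P \<in> F \<Longrightarrow> primeideal P R \<and> \<not> J \<subseteq> P"
    and "\<And>P Q. P \<in> F \<Longrightarrow> Q \<in> F \<Longrightarrow> P \<subseteq> Q \<Longrightarrow> P = Q"
  shows "\<exists>x\<in>J. \<forall>P\<in>F. x \<notin> P"
  using assms(2-4)
proof (induction F rule: finite_induct)
  case empty
  then show ?case using additive_subgroup.zero_closed[OF ideal.axioms(1)[OF assms(1)]] by blast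
next
  case (insert P F)
  interpret J: ideal J R by fact
  have "\<exists>x\<in>J. \<forall>P\<in>F. x \<notin> P" by (rule insert.IH) (use insert.prems in blast)+
  then obtain x where x: "x \<in> J" "\<forall>P\<in>F. x \<notin> P" by blast
  have P: "primeideal P R" using insert.prems by blast
  interpret P: primeideal P R by fact
  show ?case
  proof (cases "x \<in> P")
    case False
    then show ?thesis using x by blast
  next
    case True
    have "\<And>Q. Q \<in> insert J F \<Longrightarrow> ideal Q R \<and> \<not> Q \<subseteq> P"
    proof -
      fix Q assume Q: "Q \<in> insert J F"
      show "ideal Q R \<and> \<not> Q \<subseteq> P"
      proof (cases "Q = J")
        case True
        then show ?thesis using insert.prems(1)[of P] assms(1) by simp
      next
        case False
        then have QF: "Q \<in> F" using Q by simp
        then have "\<not> Q \<subseteq> P" using insert.prems(2)[of Q P] insert.hyps(2) by auto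
        then show ?thesis using insert.prems(1)[of Q] QF primeideal.axioms(1) by auto
      qed
    qed
    then obtain y where y: "y \<in> carrier R" "y \<notin> P" "y \<in> J" "\<forall>Q\<in>F. y \<in> Q"
      using prime_not_contains_Inter[OF P, of "insert J F"] insert.hyps by blast
    have xc: "x \<in> carrier R" using x J.Icarr by blast
    have e: "(x \<oplus> y) \<oplus> \<ominus> x = y" "(x \<oplus> y) \<oplus> \<ominus> y = x"
      using xc y(1) by (simp_all add: a_assoc r_neg) (simp add: a_lcomm[of x] r_neg)
    have "x \<oplus> y \<notin> P"
    proof
      assume "x \<oplus> y \<in> P"
      then have "(x \<oplus> y) \<oplus> \<ominus> x \<in> P" using True P.a_closed P.a_inv_closed by blast
      then show False using e y by simp
    qed
    moreover have "x \<oplus> y \<notin> Q" if "Q \<in> F" for Q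
    proof
      interpret Q: primeideal Q R using insert.prems that by blast
      assume "x \<oplus> y \<in> Q"
      then have "(x \<oplus> y) \<oplus> \<ominus> y \<in> Q" using y that Q.a_closed Q.a_inv_closed by blast
      then show False using e x that by simp
    qed
    ultimately show ?thesis using x y J.a_closed by (intro bexI[of _ "x \<oplus> y"]) auto
  qed
qed

text \<open>If \<open>b z \<notin> I\<close>, the annihilator of \<open>b z\<close> modulo \<open>I\<close> contains that of \<open>z\<close>, so by maximality the
  two agree; and \<open>a b z \<in> I\<close> says that \<open>a\<close> lies in the former.\<close>

lemma (in cring) maximal_colon_is_prime:
  assumes I: "ideal I R" and z: "z \<in> carrier R" "z \<notin> I"
    and max: "\<And>w. w \<in> carrier R \<Longrightarrow> w \<notin> I \<Longrightarrow> colon R I {z} \<subseteq> colon R I {w} \<Longrightarrow>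
                colon R I {w} = colon R I {z}"
  shows "primeideal (colon R I {z}) R"
proof (rule primeidealI[OF colon_singleton_ideal[OF I z(1)] is_cring])
  have "\<one> \<notin> colon R I {z}" using z by (simp add: colon_def)
  then show "carrier R \<noteq> colon R I {z}" by blast
next
  fix a b assume ab: "a \<in> carrier R" "b \<in> carrier R" "a \<otimes> b \<in> colon R I {z}"
  show "a \<in> colon R I {z} \<or> b \<in> colon R I {z}"
  proof (cases "b \<in> colon R I {z}")
    case False
    then have "b \<otimes> z \<notin> I" using ab by (simp add: colon_def)
    moreover have "colon R I {z} \<subseteq> colon R I {b \<otimes> z}"
      using ab z ideal.I_l_closed[OF I] by (auto simp: colon_def m_lcomm[of _ b z])
    ultimately have "colon R I {b \<otimes> z} = colon R I {z}" using max ab z by blast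
    moreover have "a \<in> colon R I {b \<otimes> z}" using ab z by (simp add: colon_def m_assoc)
    ultimately show ?thesis by blast
  qed blast
qed

text \<open>The zero divisors modulo \<open>I\<close> form the union of the maximal annihilators \<open>I : z\<close>, which are
  prime.  There are only finitely many of these: take finitely many \<open>t\<close> whose annihilators are
  maximal such that they generate the same ideal as all \<open>z\<close> of that kind.  An element that kills
  every \<open>t\<close> modulo \<open>I\<close> kills every \<open>z\<close>, so \<open>I : z\<close> contains the intersection of the finitely many
  \<open>I : t\<close>, hence one of them, hence equals it.  Prime avoidance then puts \<open>J\<close> inside one of these
  primes.\<close>

lemma (in noetherian_ring) ideal_of_zero_divisors_mod:
  assumes cr: "cring R" and I: "ideal I R" and J: "ideal J R"
    and zd: "\<And>x. x \<in> J \<Longrightarrow> \<exists>z\<in>carrier R - I. x \<otimes> z \<in> I"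
  shows "\<exists>z\<in>carrier R - I. J \<subseteq> colon R I {z}"
proof (rule ccontr)
  assume contra: "\<not> ?thesis"
  interpret cring R by fact
  let ?c = "\<lambda>z. colon R I {z}"
  have cid: "ideal (?c z) R" if "z \<in> carrier R" for z using colon_singleton_ideal[OF I that] .
  define Z where "Z = {z \<in> carrier R - I. \<forall>w\<in>carrier R - I. ?c z \<subseteq> ?c w \<longrightarrow> ?c w = ?c z}"
  have maxZ: "?c w = ?c z" if "z \<in> Z" "w \<in> carrier R - I" "?c z \<subseteq> ?c w" for z w
    using that unfolding Z_def by simp
  have ZI: "z \<in> carrier R - I" if "z \<in> Z" for z using that unfolding Z_def by simp
  then have Zc: "Z \<subseteq> carrier R" by blast
  have above: "\<exists>m\<in>Z. ?c z \<subseteq> ?c m" if "z \<in> carrier R - I" for z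
  proof -
    have 1: "\<And>K. K \<in> ?c ` (carrier R - I) \<Longrightarrow> ideal K R" using cid by blast
    have 2: "?c z \<in> ?c ` (carrier R - I)" using that by blast
    obtain m where m: "m \<in> carrier R - I" "?c z \<subseteq> ?c m"
      and mx: "\<forall>K\<in>?c ` (carrier R - I). ?c m \<subseteq> K \<longrightarrow> K = ?c m"
      using exists_maximal_ideal_above[OF 1 2] by auto
    have "m \<in> Z" using m(1) mx unfolding Z_def by simp
    then show ?thesis using m(2) by blast
  qed
  have prime: "primeideal (?c z) R" if "z \<in> Z" for z
    using ZI[OF that] maxZ[OF that] by (intro maximal_colon_is_prime I) simp_all
  \<comment> \<open>Maximality among the ideals generated by finite subsets of \<open>Z\<close> yields generators that
    lie in \<open>Z\<close> itself, which finite generation of the ideal of \<open>Z\<close> alone would not give.\<close>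
  obtain T where T: "T \<subseteq> Z" "finite T" "Z \<subseteq> Idl T"
  proof -
    have 1: "\<And>K. K \<in> {Idl T |T. T \<subseteq> Z \<and> finite T} \<Longrightarrow> ideal K R"
      using genideal_ideal Zc by auto
    have 2: "Idl {} \<in> {Idl T |T. T \<subseteq> Z \<and> finite T}" by (intro CollectI exI[of _ "{}"]) simp
    obtain T where T: "T \<subseteq> Z" "finite T"
      and mx: "\<forall>K\<in>{Idl T |T. T \<subseteq> Z \<and> finite T}. Idl T \<subseteq> K \<longrightarrow> K = Idl T"
      using exists_maximal_ideal_above[OF 1 2] by auto
    have "Z \<subseteq> Idl T"
    proof
      fix z assume z: "z \<in> Z"
      have ins: "insert z T \<subseteq> carrier R" using z T(1) Zc by auto
      have "Idl (insert z T) \<in> {Idl T |T. T \<subseteq> Z \<and> finite T}"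
        using z T by (intro CollectI exI[of _ "insert z T"]) simp
      moreover have "Idl T \<subseteq> Idl (insert z T)" by (rule subset_Idl_subset[OF ins subset_insertI])
      ultimately have "Idl (insert z T) = Idl T" using mx by simp
      then show "z \<in> Idl T" using genideal_self[OF ins] by simp
    qed
    then show thesis using that[OF T] by simp
  qed
  have fin: "\<exists>t\<in>T. ?c z = ?c t" if z: "z \<in> Z" for z
  proof (rule ccontr)
    assume no: "\<not> ?thesis"
    have "ideal P R \<and> \<not> P \<subseteq> ?c z" if P: "P \<in> ?c ` T" for P
    proof -
      obtain t where t: "t \<in> T" "t \<in> Z" "P = ?c t" using P T(1) by blast
      have "\<not> ?c t \<subseteq> ?c z" using maxZ[OF t(2) ZI[OF z]] no t(1) by blast
      then show ?thesis using cid ZI[OF t(2)] t(3) by blast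
    qed
    then obtain y where y: "y \<in> carrier R" "y \<notin> ?c z" "\<forall>t\<in>T. y \<in> ?c t"
      using prime_not_contains_Inter[OF prime[OF z], of "?c ` T"] T(2) by auto
    have "T \<subseteq> ?c y"
    proof
      fix t assume t: "t \<in> T"
      then have tc: "t \<in> carrier R" using T(1) Zc by auto
      have "y \<otimes> t \<in> I" using y(3) t by (simp add: colon_def)
      then show "t \<in> ?c y" using tc m_comm[OF y(1) tc] by (simp add: colon_def)
    qed
    then have "Idl T \<subseteq> ?c y" using genideal_minimal cid[OF y(1)] by blast
    then have "z \<in> ?c y" using T(3) z by auto
    then have "z \<otimes> y \<in> I" "z \<in> carrier R" by (simp_all add: colon_def)
    then show False using y(1,2) m_comm by (simp add: colon_def)
  qed
  have "\<exists>x\<in>J. \<forall>P\<in>?c ` T. x \<notin> P"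
  proof (rule prime_avoidance_antichain[OF J])
    show "finite (?c ` T)" using T by blast
    show "primeideal P R \<and> \<not> J \<subseteq> P" if P: "P \<in> ?c ` T" for P
    proof -
      obtain t where t: "t \<in> Z" "P = ?c t" using P T(1) by blast
      have "t \<in> carrier R - I" using t(1) unfolding Z_def by simp
      then show ?thesis using contra prime[OF t(1)] t(2) by blast
    qed
    show "P = Q" if PQ: "P \<in> ?c ` T" "Q \<in> ?c ` T" "P \<subseteq> Q" for P Q
    proof -
      obtain t u where tu: "t \<in> Z" "P = ?c t" "u \<in> Z" "Q = ?c u" using PQ T(1) by blast
      then show ?thesis using maxZ[OF tu(1) ZI[OF tu(3)]] PQ(3) by simp
    qed
  qed
  then obtain x where x: "x \<in> J" "\<forall>t\<in>T. x \<notin> ?c t" by blast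
  obtain z where z: "z \<in> carrier R - I" "x \<otimes> z \<in> I" using zd x by blast
  have "x \<in> ?c z" using z x ideal.Icarr[OF J] by (simp add: colon_def)
  then show False using above[OF z(1)] fin x by blast
qed

section \<open>Linear combinations of finitely many generators\<close>

definition combinations :: "('a, 'b) ring_scheme \<Rightarrow> 'a set \<Rightarrow> 'a set \<Rightarrow> 'a set"
  where "combinations R J S = {(\<Oplus>\<^bsub>R\<^esub>y\<in>S. b y \<otimes>\<^bsub>R\<^esub> y) |b. b \<in> S \<rightarrow> J}"

lemma (in cring) combinations_add:
  assumes J: "ideal J R" and "S \<subseteq> carrier R"
    and "u \<in> combinations R J S" "v \<in> combinations R J S"
  shows "u \<oplus> v \<in> combinations R J S"
proof -
  interpret J: ideal J R by fact
  obtain b c where b: "b \<in> S \<rightarrow> J" "u = (\<Oplus>y\<in>S. b y \<otimes> y)"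
    and c: "c \<in> S \<rightarrow> J" "v = (\<Oplus>y\<in>S. c y \<otimes> y)"
    using assms unfolding combinations_def by blast
  have bc: "\<And>y. y \<in> S \<Longrightarrow> b y \<in> carrier R \<and> c y \<in> carrier R \<and> y \<in> carrier R"
    using b c J.Icarr assms(2) by blast
  have "u \<oplus> v = (\<Oplus>y\<in>S. b y \<otimes> y \<oplus> c y \<otimes> y)"
    unfolding b c using bc by (intro finsum_addf[symmetric]) auto
  also have "\<dots> = (\<Oplus>y\<in>S. (b y \<oplus> c y) \<otimes> y)"
    using bc by (intro finsum_cong') (auto simp: l_distr)
  finally show ?thesis unfolding combinations_def
    using b c by (intro CollectI exI[of _ "\<lambda>y. b y \<oplus> c y"]) auto
qed

lemma (in cring) combinations_smult:
  assumes J: "ideal J R" and "finite S" "S \<subseteq> carrier R"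
    and "u \<in> combinations R (carrier R) S" "r \<in> J"
  shows "r \<otimes> u \<in> combinations R J S"
proof -
  interpret J: ideal J R by fact
  obtain b where b: "b \<in> S \<rightarrow> carrier R" "u = (\<Oplus>y\<in>S. b y \<otimes> y)"
    using assms unfolding combinations_def by blast
  have bc: "\<And>y. y \<in> S \<Longrightarrow> b y \<in> carrier R \<and> y \<in> carrier R" and r: "r \<in> carrier R"
    using b J.Icarr assms by blast+
  have "r \<otimes> u = (\<Oplus>y\<in>S. r \<otimes> (b y \<otimes> y))"
    unfolding b using bc r assms(2) by (intro finsum_rdistr) auto
  also have "\<dots> = (\<Oplus>y\<in>S. (r \<otimes> b y) \<otimes> y)"
    using bc r by (intro finsum_cong') (auto simp: m_assoc)
  finally show ?thesis unfolding combinations_def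
    using bc assms(5) by (intro CollectI exI[of _ "\<lambda>y. r \<otimes> b y"]) (auto intro: J.I_r_closed)
qed

lemma (in cring) genideal_subset_combinations:
  assumes "finite S" "S \<subseteq> carrier R"
  shows "Idl S \<subseteq> combinations R (carrier R) S"
proof (rule genideal_minimal)
  let ?C = "combinations R (carrier R) S"
  have sub: "?C \<subseteq> carrier R" using assms by (auto simp: combinations_def intro!: finsum_closed)
  have sm: "r \<otimes> u \<in> ?C" if "u \<in> ?C" "r \<in> carrier R" for r u
    using combinations_smult[OF oneideal assms] that by blast
  show "ideal ?C R"
  proof (rule idealI[OF ring_axioms])
    show "subgroup ?C (add_monoid R)"
    proof (rule add.subgroupI)
      show "?C \<noteq> {}" by (auto simp: combinations_def)
      show "\<ominus> u \<in> ?C" if "u \<in> ?C" for u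
        using sm[OF that, of "\<ominus> \<one>"] that sub by (auto simp: l_minus)
    qed (use sub combinations_add[OF oneideal assms(2)] in auto)
  qed (use sm sub m_comm in \<open>auto simp: subset_iff\<close>)
  show "S \<subseteq> ?C"
  proof
    fix s assume s: "s \<in> S"
    have "(\<Oplus>y\<in>S. (if s = y then \<one> else \<zero>) \<otimes> y) = (\<Oplus>y\<in>S. if s = y then y else \<zero>)"
      using assms by (intro finsum_cong') auto
    also have "\<dots> = s" using s assms by (intro add.finprod_singleton) auto
    finally show "s \<in> ?C" unfolding combinations_def
      by (intro CollectI exI[of _ "\<lambda>y. if s = y then \<one> else \<zero>"]) auto
  qed
qed

lemma (in cring) ideal_prod_genideal_subset_combinations:
  assumes J: "ideal J R" and S: "finite S" "S \<subseteq> carrier R"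
  shows "(Idl S) \<cdot> J \<subseteq> combinations R J S"
proof
  fix u assume "u \<in> (Idl S) \<cdot> J"
  then show "u \<in> combinations R J S"
  proof (induction rule: ideal_prod.induct)
    case (prod i j)
    then have "j \<otimes> i \<in> combinations R J S"
      using combinations_smult[OF J S] genideal_subset_combinations[OF S] by blast
    then show ?case
      using m_comm prod ideal.Icarr[OF J] ideal.Icarr[OF genideal_ideal[OF S(2)]] by simp
  qed (rule combinations_add[OF J S(2)])
qed

section \<open>Values of equations of integral dependence\<close>

text \<open>The values \<open>a\<^sub>1 x^(d-1) + \<dots> + a\<^sub>d\<close> with \<open>a\<^sub>i \<in> I^i\<close>, generated by Horner's scheme.  The recursion
  makes the closure properties below inductions on \<open>d\<close>, without reindexing of sums; lemma
  \<open>tails_expand\<close> recovers the explicit sum.\<close>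

primrec integral_tails :: "('a, 'b) ring_scheme \<Rightarrow> 'a set \<Rightarrow> 'a \<Rightarrow> nat \<Rightarrow> 'a set" where
  "integral_tails R I x 0 = {\<zero>\<^bsub>R\<^esub>}"
| "integral_tails R I x (Suc d) =
    {x \<otimes>\<^bsub>R\<^esub> u \<oplus>\<^bsub>R\<^esub> a |u a. u \<in> integral_tails R I x d \<and> a \<in> I [^]\<^bsub>ideals_set R\<^esub> Suc d}"

text \<open>The values at \<open>x\<close> of the left-hand sides of equations of integral dependence of degree \<open>d\<close>.
  Thus \<open>x\<close> is integral over \<open>I\<close> exactly if \<open>0\<close> is such a value for some \<open>d \<ge> 1\<close>.\<close>

definition monic_values :: "('a, 'b) ring_scheme \<Rightarrow> 'a set \<Rightarrow> 'a \<Rightarrow> nat \<Rightarrow> 'a set"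
  where "monic_values R I x d = {x [^]\<^bsub>R\<^esub> d \<oplus>\<^bsub>R\<^esub> e |e. e \<in> integral_tails R I x d}"

lemma (in cring) ideal_pow_ideal:
  assumes "ideal I R"
  shows "ideal (I [^]\<^bsub>ideals_set R\<^esub> (n::nat)) R"
proof -
  interpret S: comm_monoid "ideals_set R" by (rule ideals_set_is_comm_monoid)
  have "I [^]\<^bsub>ideals_set R\<^esub> n \<in> carrier (ideals_set R)"
    using assms by (intro S.nat_pow_closed) (simp add: ideals_set_def)
  then show ?thesis by (simp add: ideals_set_def)
qed

lemma (in cring) ideal_pow_mult:
  assumes "ideal I R" "a \<in> I [^]\<^bsub>ideals_set R\<^esub> (m::nat)" "b \<in> I [^]\<^bsub>ideals_set R\<^esub> (n::nat)"
  shows "a \<otimes> b \<in> I [^]\<^bsub>ideals_set R\<^esub> (m + n)"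
proof -
  interpret S: comm_monoid "ideals_set R" by (rule ideals_set_is_comm_monoid)
  have "a \<otimes> b \<in> (I [^]\<^bsub>ideals_set R\<^esub> m) \<cdot> (I [^]\<^bsub>ideals_set R\<^esub> n)"
    using assms by (intro ideal_prod.prod)
  also have "\<dots> = I [^]\<^bsub>ideals_set R\<^esub> (m + n)"
    using S.nat_pow_mult[of I m n] assms by (simp add: ideals_set_def)
  finally show ?thesis .
qed

context cring
begin

context
  fixes I x assumes I: "ideal I R" and x: "x \<in> carrier R"
begin

abbreviation "tails \<equiv> integral_tails R I x"
abbreviation "monics \<equiv> monic_values R I x"

lemma tails_closed: "u \<in> tails d \<Longrightarrow> u \<in> carrier R"
  using x ideal.Icarr[OF ideal_pow_ideal[OF I]]
  by (induction d arbitrary: u) (auto simp del: Group.nat_pow_Suc)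

lemma tails_add: "u \<in> tails d \<Longrightarrow> v \<in> tails d \<Longrightarrow> u \<oplus> v \<in> tails d"
proof (induction d arbitrary: u v)
  case (Suc d)
  interpret P: ideal "I [^]\<^bsub>ideals_set R\<^esub> Suc d" R by (rule ideal_pow_ideal[OF I])
  obtain u' a v' b where *: "u = x \<otimes> u' \<oplus> a" "v = x \<otimes> v' \<oplus> b" "u' \<in> tails d" "v' \<in> tails d"
    "a \<in> I [^]\<^bsub>ideals_set R\<^esub> Suc d" "b \<in> I [^]\<^bsub>ideals_set R\<^esub> Suc d"
    using Suc.prems by (auto simp del: Group.nat_pow_Suc)
  have "u \<oplus> v = x \<otimes> (u' \<oplus> v') \<oplus> (a \<oplus> b)"
    unfolding * using * x tails_closed P.Icarr by (simp add: r_distr a_ac del: Group.nat_pow_Suc)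
  moreover have "u' \<oplus> v' \<in> tails d" using Suc.IH * by blast
  moreover have "a \<oplus> b \<in> I [^]\<^bsub>ideals_set R\<^esub> Suc d" using * P.a_closed by blast
  ultimately show ?case unfolding integral_tails.simps by blast
qed simp

lemma tails_minus: "u \<in> tails d \<Longrightarrow> \<ominus> u \<in> tails d"
proof (induction d arbitrary: u)
  case (Suc d)
  interpret P: ideal "I [^]\<^bsub>ideals_set R\<^esub> Suc d" R by (rule ideal_pow_ideal[OF I])
  obtain u' a where *: "u = x \<otimes> u' \<oplus> a" "u' \<in> tails d" "a \<in> I [^]\<^bsub>ideals_set R\<^esub> Suc d"
    using Suc.prems by (auto simp del: Group.nat_pow_Suc)
  have "\<ominus> u = x \<otimes> (\<ominus> u') \<oplus> (\<ominus> a)"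
    unfolding * using * x tails_closed P.Icarr by (simp add: r_minus minus_add del: Group.nat_pow_Suc)
  moreover have "\<ominus> u' \<in> tails d" using Suc.IH * by blast
  moreover have "\<ominus> a \<in> I [^]\<^bsub>ideals_set R\<^esub> Suc d" using * P.a_inv_closed by blast
  ultimately show ?case unfolding integral_tails.simps by blast
qed simp

lemma zero_in_tails: "\<zero> \<in> tails d"
proof (induction d)
  case (Suc d)
  interpret P: ideal "I [^]\<^bsub>ideals_set R\<^esub> Suc d" R by (rule ideal_pow_ideal[OF I])
  have "\<zero> = x \<otimes> \<zero> \<oplus> \<zero>" using x by simp
  then show ?case using Suc P.zero_closed unfolding integral_tails.simps by blast
qed simp

lemma tails_shift: "u \<in> tails d \<Longrightarrow> x \<otimes> u \<in> tails (Suc d)"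
proof -
  assume u: "u \<in> tails d"
  interpret P: ideal "I [^]\<^bsub>ideals_set R\<^esub> Suc d" R by (rule ideal_pow_ideal[OF I])
  have "x \<otimes> u = x \<otimes> u \<oplus> \<zero>" using x u tails_closed by simp
  then show ?thesis using u P.zero_closed unfolding integral_tails.simps by blast
qed

lemma tails_shift_pow: "u \<in> tails d \<Longrightarrow> x [^] (n::nat) \<otimes> u \<in> tails (n + d)"
proof (induction n)
  case (Suc n)
  have "x [^] Suc n \<otimes> u = x \<otimes> (x [^] n \<otimes> u)"
    using x Suc.prems tails_closed by (simp add: m_ac)
  then show ?case using tails_shift Suc by simp
qed (simp add: tails_closed)

lemma pow_subset_tails:
  assumes "a \<in> I [^]\<^bsub>ideals_set R\<^esub> Suc d" shows "a \<in> tails (Suc d)"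
proof -
  have "a = x \<otimes> \<zero> \<oplus> a" using x assms ideal.Icarr[OF ideal_pow_ideal[OF I]] by (simp del: Group.nat_pow_Suc)
  then show ?thesis using assms zero_in_tails unfolding integral_tails.simps by blast
qed

lemma pow_mult_tails:
  "a \<in> I [^]\<^bsub>ideals_set R\<^esub> Suc k \<Longrightarrow> v \<in> tails e \<Longrightarrow> a \<otimes> v \<in> tails (Suc k + e)"
proof (induction e arbitrary: v)
  case 0
  then show ?case using zero_in_tails ideal.Icarr[OF ideal_pow_ideal[OF I]]
    by (simp del: Group.nat_pow_Suc integral_tails.simps(2))
next
  case (Suc e)
  obtain w b where *: "v = x \<otimes> w \<oplus> b" "w \<in> tails e" "b \<in> I [^]\<^bsub>ideals_set R\<^esub> Suc e"
    using Suc.prems by (auto simp del: Group.nat_pow_Suc)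
  have c: "a \<in> carrier R" "b \<in> carrier R" "w \<in> carrier R"
    using * Suc.prems ideal.Icarr[OF ideal_pow_ideal[OF I]] tails_closed by blast+
  have "a \<otimes> v = x \<otimes> (a \<otimes> w) \<oplus> a \<otimes> b"
    unfolding * using c x by (simp add: r_distr m_lcomm)
  moreover have "x \<otimes> (a \<otimes> w) \<in> tails (Suc (Suc k + e))" using tails_shift Suc * by blast
  moreover have "a \<otimes> b \<in> tails (Suc (Suc k + e))"
    using pow_subset_tails[of _ "Suc k + e"] ideal_pow_mult[OF I Suc.prems(1) *(3)]
    by (simp del: Group.nat_pow_Suc integral_tails.simps(2))
  ultimately show ?case using tails_add by (metis add_Suc_right)
qed

text \<open>The tails of all degrees behave like the lower terms of monic polynomials over the Rees algebra
  of \<open>I\<close>: this lemma and the next ones say that products and perturbations of monic values are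
  again monic values, with degrees adding up.\<close>

lemma tails_mult: "u \<in> tails d \<Longrightarrow> v \<in> tails e \<Longrightarrow> u \<otimes> v \<in> tails (d + e)"
proof (induction d arbitrary: u)
  case 0
  then show ?case using zero_in_tails tails_closed by simp
next
  case (Suc d)
  obtain w b where *: "u = x \<otimes> w \<oplus> b" "w \<in> tails d" "b \<in> I [^]\<^bsub>ideals_set R\<^esub> Suc d"
    using Suc.prems by (auto simp del: Group.nat_pow_Suc)
  have c: "b \<in> carrier R" "w \<in> carrier R" "v \<in> carrier R"
    using * Suc.prems ideal.Icarr[OF ideal_pow_ideal[OF I]] tails_closed by blast+
  have "u \<otimes> v = x \<otimes> (w \<otimes> v) \<oplus> b \<otimes> v"
    unfolding * using c x by (simp add: l_distr m_assoc)
  moreover have "x \<otimes> (w \<otimes> v) \<in> tails (Suc (d + e))" using tails_shift Suc * by blast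
  moreover have "b \<otimes> v \<in> tails (Suc d + e)" using pow_mult_tails * Suc.prems by blast
  ultimately show ?case using tails_add by (metis add_Suc)
qed

lemma monics_closed: "s \<in> monics d \<Longrightarrow> s \<in> carrier R"
  using x tails_closed by (auto simp: monic_values_def)

lemma monics_mult_tails: "s \<in> monics d \<Longrightarrow> u \<in> tails e \<Longrightarrow> s \<otimes> u \<in> tails (d + e)"
  using x tails_closed tails_shift_pow tails_mult tails_add
  by (auto simp: monic_values_def l_distr)

lemma monics_add_tails: "s \<in> monics d \<Longrightarrow> u \<in> tails d \<Longrightarrow> s \<oplus> u \<in> monics d"
proof -
  assume *: "s \<in> monics d" "u \<in> tails d"
  then obtain e where e: "e \<in> tails d" "s = x [^] d \<oplus> e" by (auto simp: monic_values_def)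
  have "s \<oplus> u = x [^] d \<oplus> (e \<oplus> u)" using e * x tails_closed by (simp add: a_assoc)
  then show ?thesis using e * tails_add unfolding monic_values_def by blast
qed

lemma monics_mult: "s \<in> monics d \<Longrightarrow> t \<in> monics e \<Longrightarrow> s \<otimes> t \<in> monics (d + e)"
proof -
  assume *: "s \<in> monics d" "t \<in> monics e"
  then obtain u where u: "u \<in> tails e" "t = x [^] e \<oplus> u" by (auto simp: monic_values_def)
  obtain w where w: "w \<in> tails d" "s = x [^] d \<oplus> w" using * by (auto simp: monic_values_def)
  have "s \<otimes> x [^] e = x [^] (d + e) \<oplus> x [^] e \<otimes> w"
    unfolding w(2) using x tails_closed[OF w(1)] by (simp add: l_distr nat_pow_mult m_comm[of w])
  moreover have "x [^] e \<otimes> w \<in> tails (d + e)" using tails_shift_pow[OF w(1), of e] by (simp only: Groups.add.commute)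
  ultimately have "s \<otimes> x [^] e \<in> monics (d + e)" unfolding monic_values_def by blast
  moreover have "s \<otimes> t = s \<otimes> x [^] e \<oplus> s \<otimes> u"
    unfolding u(2) using u * x tails_closed monics_closed by (simp add: r_distr)
  ultimately show ?thesis using monics_add_tails monics_mult_tails[OF *(1) u(1)] by simp
qed

lemma tails_expand:
  "u \<in> tails d \<Longrightarrow> \<exists>a. (\<forall>i\<in>{1..d}. a i \<in> I [^]\<^bsub>ideals_set R\<^esub> i) \<and>
     u = (\<Oplus>i\<in>{1..d}. a i \<otimes> x [^] (d - i))"
proof (induction d arbitrary: u)
  case (Suc d)
  obtain w b where *: "u = x \<otimes> w \<oplus> b" "w \<in> tails d" "b \<in> I [^]\<^bsub>ideals_set R\<^esub> Suc d"
    using Suc.prems by (auto simp del: Group.nat_pow_Suc)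
  obtain a where a: "\<forall>i\<in>{1..d}. a i \<in> I [^]\<^bsub>ideals_set R\<^esub> i"
    "w = (\<Oplus>i\<in>{1..d}. a i \<otimes> x [^] (d - i))" using Suc.IH *(2) by blast
  have ac: "a i \<in> carrier R" if "i \<in> {1..d}" for i
    using that a ideal.Icarr[OF ideal_pow_ideal[OF I]] by blast
  have bc: "b \<in> carrier R" using * ideal.Icarr[OF ideal_pow_ideal[OF I]] by blast
  let ?a = "a(Suc d := b)"
  have "x \<otimes> w = (\<Oplus>i\<in>{1..d}. x \<otimes> (a i \<otimes> x [^] (d - i)))"
    unfolding a(2) using x ac by (intro finsum_rdistr) auto
  also have "\<dots> = (\<Oplus>i\<in>{1..d}. ?a i \<otimes> x [^] (Suc d - i))"
    using x ac by (intro finsum_cong') (auto simp: m_ac Suc_diff_le)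
  finally have "u = (\<Oplus>i\<in>{1..d}. ?a i \<otimes> x [^] (Suc d - i)) \<oplus> ?a (Suc d) \<otimes> x [^] (Suc d - Suc d)"
    unfolding * using bc by simp
  also have "\<dots> = (\<Oplus>i\<in>insert (Suc d) {1..d}. ?a i \<otimes> x [^] (Suc d - i))"
    using x ac bc by (subst finsum_insert) (auto intro!: a_comm finsum_closed)
  also have "insert (Suc d) {1..d} = {1..Suc d}" by auto
  finally have "u = (\<Oplus>i\<in>{1..Suc d}. ?a i \<otimes> x [^] (Suc d - i))" .
  moreover have "\<forall>i\<in>{1..Suc d}. ?a i \<in> I [^]\<^bsub>ideals_set R\<^esub> i"
    using a * by (auto simp del: Group.nat_pow_Suc simp: le_Suc_eq)
  ultimately show ?case by blast
qed simp

lemma zero_monic_imp_integral: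
  assumes "d \<ge> 1" "\<zero> \<in> monics d"
  shows "x \<in> integral_closure_ideal R I"
proof -
  obtain e where e: "e \<in> tails d" "\<zero> = x [^] d \<oplus> e" using assms by (auto simp: monic_values_def)
  then show ?thesis using tails_expand[OF e(1)] x assms(1)
    unfolding integral_closure_ideal_def by (intro CollectI conjI exI[of _ d]) auto
qed

text \<open>A replacement for the determinant in the Cayley-Hamilton argument.  The matrix \<open>F\<close> of relations
  has monic diagonal and lower-order tails as off-diagonal entries, all of degree \<open>d\<close>.
  Multiplying row \<open>i\<close> by the pivot \<open>F t t\<close> and subtracting \<open>F i t\<close> times row \<open>t\<close> removes the generator \<open>m t\<close> without any
  division and gives a matrix of the same shape in degree \<open>2 d\<close>.  If \<open>s\<close> kills the remaining
  generators, row \<open>t\<close> shows that \<open>s F t t\<close> kills \<open>m t\<close> as well.\<close>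

lemma monic_annihilates_generators:
  assumes "finite T"
    and "\<And>j. j \<in> T \<Longrightarrow> m j \<in> carrier R"
    and "\<And>i. i \<in> T \<Longrightarrow> F i i \<in> monics d"
    and "\<And>i j. i \<in> T \<Longrightarrow> j \<in> T \<Longrightarrow> i \<noteq> j \<Longrightarrow> F i j \<in> tails d"
    and "\<And>i. i \<in> T \<Longrightarrow> (\<Oplus>j\<in>T. F i j \<otimes> m j) = \<zero>"
  shows "\<exists>D\<ge>1. \<exists>s\<in>monics D. \<forall>j\<in>T. s \<otimes> m j = \<zero>"
  using assms
proof (induction T arbitrary: d F rule: finite_induct)
  case empty
  have "x [^] (1::nat) \<oplus> \<zero> \<in> monics 1" using zero_in_tails unfolding monic_values_def by blast
  then show ?case by blast
next
  case (insert t T)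
  note mc = insert.prems(1) and diag = insert.prems(2) and off = insert.prems(3)
    and rel = insert.prems(4)
  have Fc: "F i j \<in> carrier R" if "i \<in> insert t T" "j \<in> insert t T" for i j
    using monics_closed[OF diag[OF that(1)]] tails_closed[OF off[OF that]] by (cases "i = j") blast+
  define S where "S i = (\<Oplus>j\<in>T. F i j \<otimes> m j)" for i
  have Sc: "S i \<in> carrier R" if "i \<in> insert t T" for i
    unfolding S_def using that Fc mc by (intro finsum_closed) auto
  have row: "F i t \<otimes> m t \<oplus> S i = \<zero>" if "i \<in> insert t T" for i
    using rel[OF that] insert.hyps that Fc mc unfolding S_def by (subst (asm) finsum_insert) auto
  define G where "G i j = F t t \<otimes> F i j \<oplus> \<ominus> (F i t \<otimes> F t j)" for i j
  have Gdiag: "G i i \<in> monics (d + d)" if "i \<in> T" for i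
    unfolding G_def using that insert.hyps diag off
    by (intro monics_add_tails monics_mult tails_minus tails_mult) auto
  have Goff: "G i j \<in> tails (d + d)" if "i \<in> T" "j \<in> T" "i \<noteq> j" for i j
    unfolding G_def using that insert.hyps diag off
    by (intro tails_add monics_mult_tails tails_minus tails_mult) auto
  have Grel: "(\<Oplus>j\<in>T. G i j \<otimes> m j) = \<zero>" if i: "i \<in> T" for i
  proof -
    have "(\<Oplus>j\<in>T. G i j \<otimes> m j) =
        (\<Oplus>j\<in>T. F t t \<otimes> (F i j \<otimes> m j) \<oplus> (\<ominus> F i t) \<otimes> (F t j \<otimes> m j))"
      unfolding G_def using i Fc mc
      by (intro finsum_cong') (auto simp: l_distr m_assoc l_minus)
    also have "\<dots> = (\<Oplus>j\<in>T. F t t \<otimes> (F i j \<otimes> m j)) \<oplus> (\<Oplus>j\<in>T. (\<ominus> F i t) \<otimes> (F t j \<otimes> m j))"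
      using i Fc mc by (intro finsum_addf) auto
    also have "\<dots> = F t t \<otimes> S i \<oplus> (\<ominus> F i t) \<otimes> S t"
      unfolding S_def using i Fc mc insert.hyps by (subst (1 2) finsum_rdistr) auto
    also have "S i = \<ominus> (F i t \<otimes> m t)"
      using row[of i] i Fc mc Sc by (auto intro!: minus_equality[symmetric] simp: a_comm)
    also have "S t = \<ominus> (F t t \<otimes> m t)"
      using row[of t] Fc mc Sc by (auto intro!: minus_equality[symmetric] simp: a_comm)
    finally show ?thesis using i Fc mc by (simp add: l_minus r_minus m_lcomm l_neg)
  qed
  have "\<exists>D\<ge>1. \<exists>s\<in>monics D. \<forall>j\<in>T. s \<otimes> m j = \<zero>"
    by (rule insert.IH[of G "d + d"]) (use mc Gdiag Goff Grel in auto)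
  then obtain D s where s: "D \<ge> 1" "s \<in> monics D" "\<And>j. j \<in> T \<Longrightarrow> s \<otimes> m j = \<zero>" by blast
  have sc: "s \<in> carrier R" using s monics_closed by blast
  have "s \<otimes> S t = (\<Oplus>j\<in>T. s \<otimes> (F t j \<otimes> m j))"
    unfolding S_def using sc Fc mc insert.hyps by (intro finsum_rdistr) auto
  also have "\<dots> = (\<Oplus>j\<in>T. \<zero>)"
    using sc Fc mc s by (intro finsum_cong') (auto simp: m_lcomm[of s])
  finally have "s \<otimes> S t = \<zero>" by simp
  moreover have "s \<otimes> (F t t \<otimes> m t \<oplus> S t) = \<zero>" using row[of t] sc by simp
  ultimately have "s \<otimes> F t t \<otimes> m t = \<zero>" using sc Fc mc Sc by (simp add: r_distr m_assoc)
  moreover have "s \<otimes> F t t \<otimes> m j = \<zero>" if "j \<in> T" for j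
    using s(3)[OF that] sc Fc mc that by (metis insertCI m_assoc m_comm r_null)
  moreover have "s \<otimes> F t t \<in> monics (D + d)" using monics_mult s diag by blast
  ultimately show ?case using s(1) by (intro exI[of _ "D + d"]) auto
qed

text \<open>Writing each \<open>x y\<close> as a combination of the generators with coefficients in \<open>I\<close> gives the
  matrix \<open>x\<close> times the identity minus \<open>b\<close>, whose diagonal is monic of degree one.\<close>

lemma monic_annihilates_stable_ideal:
  assumes S: "finite S" "S \<subseteq> carrier R" and stable: "\<And>y. y \<in> S \<Longrightarrow> x \<otimes> y \<in> (Idl S) \<cdot> I"
  shows "\<exists>D\<ge>1. \<exists>s\<in>monics D. \<forall>y\<in>Idl S. s \<otimes> y = \<zero>"
proof -
  interpret I: ideal I R by (rule I)
  have "\<exists>b. b \<in> S \<rightarrow> I \<and> x \<otimes> y = (\<Oplus>z\<in>S. b z \<otimes> z)" if "y \<in> S" for y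
    using stable[OF that] ideal_prod_genideal_subset_combinations[OF I S]
    unfolding combinations_def by blast
  then obtain b where b: "\<And>y. y \<in> S \<Longrightarrow> b y \<in> S \<rightarrow> I"
    "\<And>y. y \<in> S \<Longrightarrow> x \<otimes> y = (\<Oplus>z\<in>S. b y z \<otimes> z)" by metis
  have bI: "\<And>y z. y \<in> S \<Longrightarrow> z \<in> S \<Longrightarrow> b y z \<in> I" using b(1) by blast
  have I1: "I [^]\<^bsub>ideals_set R\<^esub> Suc 0 = I"
  proof -
    interpret M: comm_monoid "ideals_set R" by (rule ideals_set_is_comm_monoid)
    show ?thesis using M.nat_pow_eone[of I] I by (simp add: ideals_set_def)
  qed
  have IE: "a \<in> tails 1" if "a \<in> I" for a using pow_subset_tails[of a 0] that I1 by simp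
  have xV: "x \<in> monics 1"
    using zero_in_tails[of 1] x unfolding monic_values_def
    by (intro CollectI exI[of _ \<zero>]) auto
  define F where "F y z = (if y = z then x else \<zero>) \<oplus> \<ominus> b y z" for y z
  have "\<exists>D\<ge>1. \<exists>s\<in>monics D. \<forall>y\<in>S. s \<otimes> y = \<zero>"
  proof (rule monic_annihilates_generators[where d = 1 and F = F])
    show "F y y \<in> monics 1" if "y \<in> S" for y
      unfolding F_def using that bI xV IE by (simp add: monics_add_tails tails_minus)
    show "F y z \<in> tails 1" if "y \<in> S" "z \<in> S" "y \<noteq> z" for y z
      unfolding F_def using that bI IE zero_in_tails[of 1] by (simp add: tails_add tails_minus)
    show "(\<Oplus>z\<in>S. F y z \<otimes> z) = \<zero>" if y: "y \<in> S" for y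
    proof -
      have zc: "z \<in> carrier R" "b y z \<in> carrier R" if "z \<in> S" for z
        using that S bI y I.Icarr by blast+
      have "(\<Oplus>z\<in>S. F y z \<otimes> z) =
          (\<Oplus>z\<in>S. (if y = z then x \<otimes> z else \<zero>) \<oplus> (\<ominus> \<one>) \<otimes> (b y z \<otimes> z))"
        unfolding F_def using zc x by (intro finsum_cong') (auto simp: l_distr l_minus)
      also have "\<dots> = (\<Oplus>z\<in>S. if y = z then x \<otimes> z else \<zero>) \<oplus> (\<Oplus>z\<in>S. (\<ominus> \<one>) \<otimes> (b y z \<otimes> z))"
        using zc x by (intro finsum_addf) auto
      also have "(\<Oplus>z\<in>S. if y = z then x \<otimes> z else \<zero>) = x \<otimes> y"
        using y zc x S(1) by (intro add.finprod_singleton) auto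
      also have "(\<Oplus>z\<in>S. (\<ominus> \<one>) \<otimes> (b y z \<otimes> z)) = (\<ominus> \<one>) \<otimes> (x \<otimes> y)"
        unfolding b(2)[OF y] using zc S(1) by (intro finsum_rdistr[symmetric]) auto
      finally show ?thesis using x y zc by (simp add: l_minus r_neg)
    qed
  qed (use S in auto)
  then obtain D s where s: "D \<ge> 1" "s \<in> monics D" "\<And>y. y \<in> S \<Longrightarrow> s \<otimes> y = \<zero>" by blast
  have sc: "s \<in> carrier R" using s monics_closed by blast
  have "S \<subseteq> {r \<in> carrier R. s \<otimes> r \<in> {\<zero>}}" using s S by auto
  then have "Idl S \<subseteq> {r \<in> carrier R. s \<otimes> r \<in> {\<zero>}}"
    using genideal_minimal ideal.helper_max_prime[OF zeroideal is_cring sc] by metis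
  then show ?thesis using s by blast
qed

end

end

section \<open>Local rings and modules of depth zero\<close>

context noetherian_local_ring
begin

lemma proper_ideal_subset_maximal:
  assumes "ideal J R" "\<one> \<notin> J"
  shows "J \<subseteq> \<mm>"
proof -
  let ?S = "{K. ideal K R \<and> \<one> \<notin> K}"
  have 1: "\<And>K. K \<in> ?S \<Longrightarrow> ideal K R" and 2: "J \<in> ?S" using assms by auto
  obtain M where M: "M \<in> ?S" "J \<subseteq> M" and mx: "\<forall>K\<in>?S. M \<subseteq> K \<longrightarrow> K = M"
    using exists_maximal_ideal_above[OF 1 2] by auto
  have "maximalideal M R"
  proof (rule maximalidealI)
    show "ideal M R" "carrier R \<noteq> M" using M by auto
    show "K = M \<or> K = carrier R" if "ideal K R" "M \<subseteq> K" for K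
      using mx that ideal.one_imp_carrier[OF that(1)] by blast
  qed
  then show ?thesis using unique_maximal M by blast
qed

lemma one_notin_maximal: "\<one> \<notin> \<mm>"
  using one_imp_carrier I_notcarr by blast

text \<open>An element outside \<open>\<mm>\<close> is a unit, and a unit can annihilate \<open>\<mm>\<close> only if \<open>\<mm> = 0\<close>, that is, if
  \<open>R\<close> is a field.\<close>

lemma annihilator_of_maximal_subset:
  assumes "\<not> field R" "s \<in> carrier R" "\<And>y. y \<in> \<mm> \<Longrightarrow> s \<otimes> y = \<zero>"
  shows "s \<in> \<mm>"
proof (rule ccontr)
  assume s: "s \<notin> \<mm>"
  have "\<one> \<in> PIdl s"
    using proper_ideal_subset_maximal[OF cgenideal_ideal[OF assms(2)]]
      cgenideal_self[OF assms(2)] s by auto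
  then obtain r where r: "r \<in> carrier R" "\<one> = r \<otimes> s" unfolding cgenideal_def by blast
  have "y = \<zero>" if "y \<in> \<mm>" for y
  proof -
    have "y = r \<otimes> (s \<otimes> y)" using r(1) r(2)[symmetric] assms(2) Icarr[OF that] by (simp flip: m_assoc)
    then show ?thesis using assms(3)[OF that] r by simp
  qed
  then have "\<mm> = {\<zero>}" using zero_closed by blast
  then show False using zeromaximalideal_fieldI is_maximalideal assms(1) by simp
qed

end

text \<open>The first entry \<open>x\<close> of a sequence is tested for being a nonzerodivisor on \<open>M\<close> modulo the
  submodule generated by no elements.  The next three lemmas show that this
  submodule is zero and that dividing by it preserves nonzerodivisors.\<close>

lemma (in module) zero_submodule: "submodule {\<zero>\<^bsub>M\<^esub>} R M"
  by (rule submoduleI) auto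

lemma (in module) ideal_smult_Idl_empty: "ideal_smult R (Idl {}) M = {\<zero>\<^bsub>M\<^esub>}"
proof -
  have "Idl {} = {\<zero>}" using R.genideal_minimal[OF R.zeroideal, of "{}"]
    additive_subgroup.zero_closed[OF ideal.axioms(1)[OF R.genideal_ideal[of "{}"]]] by auto
  moreover have "\<zero>\<^bsub>M\<^esub> \<in> N" if "submodule N R M" for N
    using subgroup.one_closed[OF submodule.axioms(1)[OF that]] by simp
  ultimately show ?thesis using zero_submodule unfolding ideal_smult_def by auto
qed

lemma (in module) nonzerodivisor_on_quot_zero:
  assumes "x \<in> carrier R" "nonzerodivisor_on M x"
  shows "nonzerodivisor_on (quot_module M {\<zero>\<^bsub>M\<^esub>}) x"
  unfolding nonzerodivisor_on_def
proof (intro ballI impI)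
  fix X assume X: "X \<in> carrier (quot_module M {\<zero>\<^bsub>M\<^esub>})"
    "x \<odot>\<^bsub>quot_module M {\<zero>\<^bsub>M\<^esub>}\<^esub> X = \<zero>\<^bsub>quot_module M {\<zero>\<^bsub>M\<^esub>}\<^esub>"
  have cos: "{\<zero>\<^bsub>M\<^esub>} +>\<^bsub>M\<^esub> v = {v}" if "v \<in> carrier M" for v
    using that by (auto simp: a_r_coset_def')
  obtain v where v: "v \<in> carrier M" "X = {\<zero>\<^bsub>M\<^esub>} +>\<^bsub>M\<^esub> v"
    using X(1) by (auto simp: quot_module_def A_RCOSETS_def')
  have "{\<zero>\<^bsub>M\<^esub>} +>\<^bsub>M\<^esub> (x \<odot>\<^bsub>M\<^esub> v) = {\<zero>\<^bsub>M\<^esub>}"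
    using X(2) smult_quot_module[OF module_axioms zero_submodule assms(1) v(1)] v(2)
    by (simp add: quot_module_def)
  then have "x \<odot>\<^bsub>M\<^esub> v = \<zero>\<^bsub>M\<^esub>" using cos assms(1) v(1) by simp
  then have "v = \<zero>\<^bsub>M\<^esub>" using assms(2) v(1) unfolding nonzerodivisor_on_def by blast
  then show "X = \<zero>\<^bsub>quot_module M {\<zero>\<^bsub>M\<^esub>}\<^esub>" using cos v by (simp add: quot_module_def)
qed

lemma a_r_coset_self_module: "J +>\<^bsub>self_module R\<^esub> z = J +>\<^bsub>R\<^esub> z"
  by (simp add: a_r_coset_def' self_module_def)

text \<open>If \<open>x \<in> \<mm>\<close> were a nonzerodivisor modulo \<open>I\<close>, the one-element list of \<open>x\<close> would be an
  \<open>R/I\<close>-regular sequence: depth zero forces \<open>R/I \<noteq> 0\<close>, so \<open>I \<subseteq> \<mm>\<close>, and \<open>x (R/I)\<close> is contained in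
  the proper submodule \<open>\<mm>/I\<close>.\<close>

lemma (in noetherian_local_ring) depth_quotient_zero_imp_zero_divisors:
  assumes I: "ideal I R" and depth0: "depth R \<mm> (quot_module (self_module R) I) = 0"
    and x: "x \<in> \<mm>"
  shows "\<exists>z\<in>carrier R - I. x \<otimes> z \<in> I"
proof (rule ccontr)
  assume "\<not> ?thesis"
  then have nzd: "\<And>z. z \<in> carrier R \<Longrightarrow> x \<otimes> z \<in> I \<Longrightarrow> z \<in> I" by blast
  interpret Id: ideal I R by fact
  let ?M = "quot_module (self_module R) I"
  note sub = submodule_self_module[OF is_cring I]
  interpret M: module R ?M by (rule module_quot_module[OF module_self_module[OF is_cring] sub])
  have "carrier ?M = {I +>\<^bsub>self_module R\<^esub> z |z. z \<in> carrier (self_module R)}"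
    by (auto simp: quot_module_def A_RCOSETS_def')
  also have "\<dots> = {I +> z |z. z \<in> carrier R}"
    unfolding a_r_coset_self_module by (simp add: self_module_def)
  finally have car: "carrier ?M = {I +> z |z. z \<in> carrier R}" .
  have smult: "r \<odot>\<^bsub>?M\<^esub> (I +> z) = I +> (r \<otimes> z)" if "r \<in> carrier R" "z \<in> carrier R" for r z
    using smult_quot_module[OF module_self_module[OF is_cring] sub, of r z] that
    by (simp add: a_r_coset_self_module) (simp add: self_module_def)
  have zeroM: "\<zero>\<^bsub>?M\<^esub> = I" by (simp add: quot_module_def)
  have addM: "(I +> y) \<oplus>\<^bsub>?M\<^esub> (I +> z) = I +> (y \<oplus> z)" if "y \<in> carrier R" "z \<in> carrier R" for y z
  proof -
    have "A <+>\<^bsub>self_module R\<^esub> B = A <+> B" for A B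
      by (simp add: set_add_def' self_module_def)
    then show ?thesis using Id.a_rcos_sum[OF that] by (simp add: quot_module_def)
  qed
  have cos_zero: "I +> z = I \<longleftrightarrow> z \<in> I" if "z \<in> carrier R" for z
    using Id.a_rcos_self[OF that] Id.a_rcos_const[of z] by auto
  have nontriv: "carrier ?M \<noteq> {\<zero>\<^bsub>?M\<^esub>}"
    using depth0 by (auto simp: depth_def)
  have "\<one> \<notin> I"
  proof
    assume "\<one> \<in> I"
    then have "I = carrier R" by (rule Id.one_imp_carrier)
    then have "carrier ?M = {\<zero>\<^bsub>?M\<^esub>}" unfolding car zeroM using cos_zero by auto
    then show False using nontriv by blast
  qed
  then have Im: "I \<subseteq> \<mm>" by (rule proper_ideal_subset_maximal[OF I])
  have xc: "x \<in> carrier R" using x Icarr by blast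
  have nzdM: "nonzerodivisor_on ?M x"
    unfolding nonzerodivisor_on_def
  proof (intro ballI impI)
    fix X assume X: "X \<in> carrier ?M" "x \<odot>\<^bsub>?M\<^esub> X = \<zero>\<^bsub>?M\<^esub>"
    obtain z where z: "z \<in> carrier R" "X = I +> z" using X(1) unfolding car by blast
    have "I +> (x \<otimes> z) = I" using X(2) smult[OF xc z(1)] z(2) zeroM by simp
    then have "z \<in> I" using cos_zero[OF m_closed[OF xc z(1)]] nzd[OF z(1)] by simp
    then show "X = \<zero>\<^bsub>?M\<^esub>" using cos_zero[OF z(1)] z(2) zeroM by simp
  qed
  let ?N = "{I +> y |y. y \<in> \<mm>}"
  have N: "submodule ?N R ?M"
  proof (rule M.submoduleI)
    show "?N \<subseteq> carrier ?M" unfolding car using Icarr by blast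
    show "\<zero>\<^bsub>?M\<^esub> \<in> ?N"
      unfolding zeroM using cos_zero[of \<zero>] by (intro CollectI exI[of _ \<zero>]) auto
    show sm: "r \<odot>\<^bsub>?M\<^esub> X \<in> ?N" if rX: "r \<in> carrier R" "X \<in> ?N" for r X
    proof -
      obtain y where y: "y \<in> \<mm>" "X = I +> y" using rX(2) by blast
      have "r \<odot>\<^bsub>?M\<^esub> X = I +> (r \<otimes> y)" using smult[OF rX(1) Icarr[OF y(1)]] y(2) by simp
      then show ?thesis using I_l_closed[OF y(1) rX(1)] by blast
    qed
    show "X \<oplus>\<^bsub>?M\<^esub> Y \<in> ?N" if XY: "X \<in> ?N" "Y \<in> ?N" for X Y
    proof -
      obtain y z where yz: "y \<in> \<mm>" "X = I +> y" "z \<in> \<mm>" "Y = I +> z"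
        using XY by blast
      have "X \<oplus>\<^bsub>?M\<^esub> Y = I +> (y \<oplus> z)"
        using addM[OF Icarr[OF yz(1)] Icarr[OF yz(3)]] yz(2,4) by simp
      then show ?thesis using a_closed[OF yz(1,3)] by blast
    qed
    show "\<ominus>\<^bsub>?M\<^esub> X \<in> ?N" if "X \<in> ?N" for X
    proof -
      have "X \<in> carrier ?M" using that unfolding car using Icarr by blast
      then have "\<ominus>\<^bsub>?M\<^esub> X = (\<ominus> \<one>) \<odot>\<^bsub>?M\<^esub> X" using M.smult_l_minus[of \<one> X] by simp
      then show ?thesis using sm[OF _ that, of "\<ominus> \<one>"] by simp
    qed
  qed
  have Ix: "Idl {x} \<subseteq> \<mm>" using genideal_minimal[OF is_ideal] x by blast
  have "a \<odot>\<^bsub>?M\<^esub> X \<in> ?N" if aX: "a \<in> Idl {x}" "X \<in> carrier ?M" for a X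
  proof -
    obtain z where z: "a \<in> \<mm>" "z \<in> carrier R" "X = I +> z"
      using aX Ix unfolding car by blast
    have "a \<odot>\<^bsub>?M\<^esub> X = I +> (a \<otimes> z)" using smult[OF Icarr[OF z(1)] z(2)] z(3) by simp
    then show ?thesis using I_r_closed[OF z(1,2)] by blast
  qed
  then have "ideal_smult R (Idl {x}) ?M \<subseteq> ?N"
    unfolding ideal_smult_def using N by (intro Inter_lower) blast
  moreover have "I +> \<one> \<notin> ?N"
  proof
    assume "I +> \<one> \<in> ?N"
    then obtain y where y: "y \<in> \<mm>" "I +> \<one> = I +> y" by blast
    have "\<one> \<in> I +> y" using Id.a_rcos_self[of \<one>] y by simp
    then obtain i where "i \<in> I" "\<one> = i \<oplus> y" by (auto simp: a_r_coset_def')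
    then have "\<one> \<in> \<mm>" using y Im a_closed by auto
    then show False using one_notin_maximal by blast
  qed
  moreover have "I +> \<one> \<in> carrier ?M" unfolding car by blast
  ultimately have "ideal_smult R (Idl {x}) ?M \<noteq> carrier ?M" by blast
  then have "regular_sequence R ?M [x]"
    unfolding regular_sequence_def
    using M.nonzerodivisor_on_quot_zero[OF xc nzdM] M.ideal_smult_Idl_empty xc by simp
  then have "enat (length [x]) \<le>
      (SUP xs \<in> {xs. set xs \<subseteq> \<mm> \<and> regular_sequence R ?M xs}. enat (length xs))"
    using x by (intro SUP_upper) auto
  then show False using depth0 nontriv by (simp add: depth_def zero_enat_def)
qed

section \<open>Integrally closed ideals of depth zero are Burch\<close>

theorem proposition4p6:
  fixes R :: "('a, 'b) ring_scheme" and \<mm> I :: "'a set"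
  assumes "noetherian_local_ring R \<mm>"
    and "infinite (carrier (R Quot \<mm>))"
    and "\<not> field R"
    and "integrally_closed_ideal R I"
    and "depth R \<mm> (quot_module (self_module R) I) = 0"
  shows "burch R \<mm> I"
  unfolding burch_def
proof
  interpret noetherian_local_ring R \<mm> by fact
  assume eq: "\<mm> \<cdot>\<^bsub>R\<^esub> colon R I \<mm> = \<mm> \<cdot>\<^bsub>R\<^esub> I"
  have I: "ideal I R" and closed: "integral_closure_ideal R I = I"
    using assms(4) by (auto simp: integrally_closed_ideal_def)
  obtain z where z: "z \<in> carrier R" "z \<notin> I" "\<mm> \<subseteq> colon R I {z}"
    using ideal_of_zero_divisors_mod[OF is_cring I is_ideal]
      depth_quotient_zero_imp_zero_divisors[OF I assms(5)] by auto
  have "y \<otimes>\<^bsub>R\<^esub> z \<in> I" if "y \<in> \<mm>" for y using z(3) that by (auto simp: colon_def)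
  then have "z \<in> colon R I \<mm>" using z(1) Icarr by (simp add: colon_def m_comm[of z])
  then have stable: "z \<otimes>\<^bsub>R\<^esub> y \<in> \<mm> \<cdot>\<^bsub>R\<^esub> I" if "y \<in> \<mm>" for y
    using ideal_prod.prod[OF that, of z "colon R I \<mm>" R] eq z(1) Icarr[OF that]
    by (simp add: m_comm)
  obtain S where S: "finite S" "S \<subseteq> carrier R" "\<mm> = Idl\<^bsub>R\<^esub> S"
    using finetely_gen[OF is_ideal] by blast
  have "\<And>y. y \<in> S \<Longrightarrow> z \<otimes>\<^bsub>R\<^esub> y \<in> (Idl\<^bsub>R\<^esub> S) \<cdot>\<^bsub>R\<^esub> I"
    using stable genideal_self[OF S(2)] S(3) by auto
  then obtain D s where s: "D \<ge> 1" "s \<in> monic_values R I z D"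
    "\<And>y. y \<in> \<mm> \<Longrightarrow> s \<otimes>\<^bsub>R\<^esub> y = \<zero>\<^bsub>R\<^esub>"
    using monic_annihilates_stable_ideal[OF I z(1) S(1,2)] S(3) by auto
  have "s \<in> \<mm>"
    by (rule annihilator_of_maximal_subset[OF assms(3) monics_closed[OF I z(1) s(2)] s(3)])
  then have "\<zero>\<^bsub>R\<^esub> \<in> monic_values R I z (D + D)"
    using monics_mult[OF I z(1) s(2) s(2)] s(3) by simp
  then have "z \<in> integral_closure_ideal R I"
    using zero_monic_imp_integral[OF I z(1), of "D + D"] s(1) by simp
  then show False using closed z(2) by simp
qed

end
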